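(* Suppose that there exist three 4-GDDs of type $g_{1}g_{2}\ldots g_{s}$ (on the same point set with the same groups) which intersect in exactly $b$ blocks. Suppose that for each $1\leq i\leq s$ there exist three $S(2,4,g_{i}+4)$ designs with exactly $b_{i}$ common blocks, all of which contain a common block $y$. Then there exist three $S(2,4,\sum_{i=1}^{s}g_{i}+4)$ designs with exactly $b+\sum_{i=1}^{s}b_{i}-(s-1)$ common blocks.
   Context: An $S(2,4,v)$ design is a pair $(\mathcal{V},\mathcal{B})$ with $|\mathcal{V}|=v$ and $\mathcal{B}$ a family of 4-subsets (blocks) of $\mathcal{V}$ such that each 2-subset of $\mathcal{V}$ lies in exactly one block. A 4-GDD of type $g_1g_2\cdots g_s$ is a triple $(\mathcal{X},\mathcal{G},\mathcal{A})$ where $\mathcal{G}=\{G_1,\dots,G_s\}$ is a partition of the finite set $\mathcal{X}$ into groups with $|G_i|=g_i$, $\mathcal{A}$ is a set of 4-subsets of $\mathcal{X}$ (blocks), each block meets each group in at most one element, and every pair of elements from distinct groups lies in exactly one block. Three designs (or three GDDs on the same points with the same groups) with block sets $\mathcal{B}_1,\mathcal{B}_2,\mathcal{B}_3$ have (intersect in) exactly $b$ common blocks if $\mathcal{B}_1\cap\mathcal{B}_2=\mathcal{B}_1\cap\mathcal{B}_3=\mathcal{B}_2\cap\mathcal{B}_3$ and this set has exactly $b$ blocks. *)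

theory Defs
  imports Main "HOL-Library.Disjoint_Sets"
begin

definition S_2_4_design :: "nat \<Rightarrow> 'a set \<Rightarrow> 'a set set \<Rightarrow> bool" where
  "S_2_4_design v V \<B> \<longleftrightarrow>
     finite V \<and> card V = v \<and>
     (\<forall>B\<in>\<B>. B \<subseteq> V \<and> card B = 4) \<and>
     (\<forall>P. P \<subseteq> V \<and> card P = 2 \<longrightarrow> (\<exists>!B. B \<in> \<B> \<and> P \<subseteq> B))"

definition GDD_4 :: "'a set \<Rightarrow> 'a set set \<Rightarrow> 'a set set \<Rightarrow> bool" where
  "GDD_4 X \<G> \<A> \<longleftrightarrow>
     finite X \<and> partition_on X \<G> \<and>
     (\<forall>A\<in>\<A>. A \<subseteq> X \<and> card A = 4) \<and>
     (\<forall>A\<in>\<A>. \<forall>G\<in>\<G>. card (A \<inter> G) \<le> 1) \<and>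
     (\<forall>G\<in>\<G>. \<forall>H\<in>\<G>. G \<noteq> H \<longrightarrow>
        (\<forall>x\<in>G. \<forall>y\<in>H. \<exists>!A. A \<in> \<A> \<and> x \<in> A \<and> y \<in> A))"

text \<open>The type g 1, ..., g s of a group set is recorded up to reordering of the groups,
  but with multiplicities: the enumeration below is a bijection.\<close>

definition has_group_type :: "'a set set \<Rightarrow> nat \<Rightarrow> (nat \<Rightarrow> nat) \<Rightarrow> bool" where
  "has_group_type \<G> s g \<longleftrightarrow>
     (\<exists>G. bij_betw G {1..s} \<G> \<and> (\<forall>i\<in>{1..s}. card (G i) = g i))"

definition exactly_common_blocks ::
    "'a set set \<Rightarrow> 'a set set \<Rightarrow> 'a set set \<Rightarrow> nat \<Rightarrow> bool" where
  "exactly_common_blocks \<B>1 \<B>2 \<B>3 b \<longleftrightarrow>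
     \<B>1 \<inter> \<B>2 = \<B>1 \<inter> \<B>3 \<and> \<B>1 \<inter> \<B>3 = \<B>2 \<inter> \<B>3 \<and>
     finite (\<B>1 \<inter> \<B>2) \<and> card (\<B>1 \<inter> \<B>2) = b"

end

theory Submission imports Defs "HOL-Library.Countable_Set" begin

text \<open>Adjoin a set \<open>Y\<close> of four new points, and fill each group \<open>G\<close> of the three GDDs with the three given
  designs, moved to \<open>G \<union> Y\<close> so that their common block becomes \<open>Y\<close>. The sets of common blocks of the
  fillings and of the GDDs are disjoint up to \<open>Y\<close>, which every filling contains; so counting \<open>Y\<close> once
  rather than \<open>s\<close> times gives the correction \<open>- (s - 1)\<close>.\<close>

section \<open>Two-point form of designs and basic facts\<close>

text \<open>A 2-subset is the same as two distinct points. In this form the design axiom has the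
  shape of the pair axiom of a GDD, so one transport lemma serves both, and pairs in a filled design
  can be sorted by where their two points lie.\<close>

lemma S_2_4_design_pairs:
  "S_2_4_design v V \<B> \<longleftrightarrow>
     finite V \<and> card V = v \<and> (\<forall>B\<in>\<B>. B \<subseteq> V \<and> card B = 4) \<and>
     (\<forall>x\<in>V. \<forall>y\<in>V. x \<noteq> y \<longrightarrow> (\<exists>!B. B \<in> \<B> \<and> x \<in> B \<and> y \<in> B))"
proof -
  have "(\<forall>P. P \<subseteq> V \<and> card P = 2 \<longrightarrow> (\<exists>!B. B \<in> \<B> \<and> P \<subseteq> B)) \<longleftrightarrow>
        (\<forall>x\<in>V. \<forall>y\<in>V. x \<noteq> y \<longrightarrow> (\<exists>!B. B \<in> \<B> \<and> {x, y} \<subseteq> B))"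
  proof (intro iffI ballI impI allI)
    fix x y assume "\<forall>P. P \<subseteq> V \<and> card P = 2 \<longrightarrow> (\<exists>!B. B \<in> \<B> \<and> P \<subseteq> B)"
      and "x \<in> V" "y \<in> V" "x \<noteq> y"
    then show "\<exists>!B. B \<in> \<B> \<and> {x, y} \<subseteq> B"
      by (metis card_2_iff empty_subsetI insert_subset)
  next
    fix P assume *: "\<forall>x\<in>V. \<forall>y\<in>V. x \<noteq> y \<longrightarrow> (\<exists>!B. B \<in> \<B> \<and> {x, y} \<subseteq> B)"
      and P: "P \<subseteq> V \<and> card P = 2"
    obtain x y where "P = {x, y}" "x \<noteq> y"
      using P by (auto simp: card_2_iff)
    with * P show "\<exists>!B. B \<in> \<B> \<and> P \<subseteq> B" by auto
  qed
  then show ?thesis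
    unfolding S_2_4_design_def by simp
qed

lemma S_2_4_designD:
  assumes "S_2_4_design v V \<B>" "B \<in> \<B>"
  shows "B \<subseteq> V" "card B = 4"
  using assms unfolding S_2_4_design_def by simp_all

lemma GDD_4D:
  assumes "GDD_4 X \<G> \<A>"
  shows "finite X" "partition_on X \<G>" "A \<in> \<A> \<Longrightarrow> A \<subseteq> X" "A \<in> \<A> \<Longrightarrow> card A = 4"
    "A \<in> \<A> \<Longrightarrow> G \<in> \<G> \<Longrightarrow> card (A \<inter> G) \<le> 1"
  using assms unfolding GDD_4_def by simp_all

lemma partition_on_Int_empty:
  assumes "partition_on X \<G>" "G \<in> \<G>" "H \<in> \<G>" "G \<noteq> H"
  shows "G \<inter> H = {}"
  using assms unfolding partition_on_def disjoint_def by simp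

section \<open>Transport along injections\<close>

lemma inj_on_mem_image_subset:
  assumes "inj_on f V" "x \<in> V" "B \<subseteq> V"
  shows "f x \<in> f ` B \<longleftrightarrow> x \<in> B"
  using assms by (auto dest: inj_onD)

text \<open>Since \<open>f\<close> is injective on \<open>V\<close> and blocks stay inside
  \<open>V\<close>, an image block through \<open>f x\<close> and \<open>f y\<close> comes from a
  block through \<open>x\<close> and \<open>y\<close>. Uniqueness is thereby pulled back to
  \<open>\<B>\<close>.\<close>

lemma ex1_block_image:
  assumes "inj_on f V" "\<forall>B\<in>\<B>. B \<subseteq> V" "x \<in> V" "y \<in> V"
    and "\<exists>!B. B \<in> \<B> \<and> x \<in> B \<and> y \<in> B"
  shows "\<exists>!B. B \<in> (`) f ` \<B> \<and> f x \<in> B \<and> f y \<in> B"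
proof -
  obtain B where B: "B \<in> \<B>" "x \<in> B" "y \<in> B"
      and unique: "\<And>C. C \<in> \<B> \<Longrightarrow> x \<in> C \<Longrightarrow> y \<in> C \<Longrightarrow> C = B"
    using assms(5) by blast
  show ?thesis
  proof (intro ex1I[of _ "f ` B"])
    fix C assume C: "C \<in> (`) f ` \<B> \<and> f x \<in> C \<and> f y \<in> C"
    then obtain C' where C': "C' \<in> \<B>" "C = f ` C'" by blast
    then have "x \<in> C'" "y \<in> C'"
      using C inj_on_mem_image_subset[OF assms(1)] assms(2-4) by metis+
    then show "C = f ` B"
      using unique C' by blast
  qed (use B in blast)
qed

lemma S_2_4_design_image:
  assumes "S_2_4_design v V \<B>" "inj_on f V"
  shows "S_2_4_design v (f ` V) ((`) f ` \<B>)"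
proof -
  have D: "finite V" "card V = v" "\<forall>B\<in>\<B>. B \<subseteq> V" "\<forall>B\<in>\<B>. card B = 4"
    "\<And>x y. x \<in> V \<Longrightarrow> y \<in> V \<Longrightarrow> x \<noteq> y \<Longrightarrow> \<exists>!B. B \<in> \<B> \<and> x \<in> B \<and> y \<in> B"
    using assms(1) unfolding S_2_4_design_pairs by auto
  have "\<exists>!B. B \<in> (`) f ` \<B> \<and> x \<in> B \<and> y \<in> B" if xy: "x \<in> f ` V" "y \<in> f ` V" "x \<noteq> y" for x y
  proof -
    obtain u w where "u \<in> V" "w \<in> V" "x = f u" "y = f w" "u \<noteq> w"
      using xy by auto
    then show ?thesis
      using ex1_block_image[OF assms(2) D(3) _ _ D(5)] by auto
  qed
  moreover have "card (f ` B) = 4" if "B \<in> \<B>" for B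
    using that D card_image[OF inj_on_subset[OF assms(2)]] by metis
  moreover have "card (f ` V) = v"
    using D(2) card_image[OF assms(2)] by simp
  ultimately show ?thesis
    unfolding S_2_4_design_pairs using D(1,3) by (simp add: image_mono)
qed

lemma GDD_4_image:
  assumes "GDD_4 X \<G> \<A>" "inj_on f X"
  shows "GDD_4 (f ` X) ((`) f ` \<G>) ((`) f ` \<A>)"
proof -
  have D: "finite X" "partition_on X \<G>" "\<forall>A\<in>\<A>. A \<subseteq> X" "\<And>A. A \<in> \<A> \<Longrightarrow> card A = 4"
    "\<And>A G. A \<in> \<A> \<Longrightarrow> G \<in> \<G> \<Longrightarrow> card (A \<inter> G) \<le> 1"
    "\<And>G H x y. G \<in> \<G> \<Longrightarrow> H \<in> \<G> \<Longrightarrow> G \<noteq> H \<Longrightarrow> x \<in> G \<Longrightarrow> y \<in> H \<Longrightarrow> \<exists>!A. A \<in> \<A> \<and> x \<in> A \<and> y \<in> A"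
    using assms(1) unfolding GDD_4_def by auto
  have sub: "G \<subseteq> X" if "G \<in> \<G>" for G
    using D(2) that unfolding partition_on_def by blast
  have "disjnt (f ` G) (f ` H)" if "G \<in> \<G>" "H \<in> \<G>" "f ` G \<noteq> f ` H" for G H
  proof -
    have "G \<inter> H = {}"
      using partition_on_Int_empty[OF D(2)] that by blast
    then show ?thesis
      using inj_on_image_Int[OF assms(2) sub sub, of G H] that by (auto simp: disjnt_def)
  qed
  then have part: "partition_on (f ` X) ((`) f ` \<G>)"
    using D(2) unfolding partition_on_def disjoint_def disjnt_def by auto
  have "card (f ` A) = 4" if "A \<in> \<A>" for A
    using that D(3,4) card_image[OF inj_on_subset[OF assms(2)]] by metis
  moreover have "card (f ` A \<inter> f ` G) \<le> 1" if "A \<in> \<A>" "G \<in> \<G>" for A G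
  proof -
    have "f ` A \<inter> f ` G = f ` (A \<inter> G)"
      using inj_on_image_Int[OF assms(2), of A G] D(3) sub that by auto
    moreover have "finite (A \<inter> G)"
      using that D(1,3) finite_subset by blast
    ultimately show ?thesis
      using card_image_le[of "A \<inter> G" f] D(5)[OF that] by simp
  qed
  moreover have "\<exists>!A. A \<in> (`) f ` \<A> \<and> f x \<in> A \<and> f y \<in> A"
    if "G \<in> \<G>" "H \<in> \<G>" "f ` G \<noteq> f ` H" "x \<in> G" "y \<in> H" for G H x y
  proof (rule ex1_block_image[OF assms(2) D(3)])
    show "\<exists>!A. A \<in> \<A> \<and> x \<in> A \<and> y \<in> A"
      using that by (intro D(6)[of G H]) auto
  qed (use sub that in auto)
  ultimately show ?thesis
    unfolding GDD_4_def using D(1,3) part by (simp add: image_mono)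
qed

lemma exactly_common_blocks_image:
  assumes "exactly_common_blocks \<B>1 \<B>2 \<B>3 b" "inj_on h \<C>" "\<B>1 \<subseteq> \<C>" "\<B>2 \<subseteq> \<C>" "\<B>3 \<subseteq> \<C>"
  shows "exactly_common_blocks (h ` \<B>1) (h ` \<B>2) (h ` \<B>3) b"
proof -
  have "h ` \<B>1 \<inter> h ` \<B>2 = h ` (\<B>1 \<inter> \<B>2)" "h ` \<B>1 \<inter> h ` \<B>3 = h ` (\<B>1 \<inter> \<B>3)"
    "h ` \<B>2 \<inter> h ` \<B>3 = h ` (\<B>2 \<inter> \<B>3)"
    using inj_on_image_Int[OF assms(2)] assms(3-5) by auto
  moreover have "card (h ` (\<B>1 \<inter> \<B>2)) = card (\<B>1 \<inter> \<B>2)"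
    using assms(2,3) by (intro card_image) (auto intro: inj_on_subset)
  ultimately show ?thesis
    using assms(1) unfolding exactly_common_blocks_def by auto
qed

text \<open>Equal cardinalities give bijections from \<open>y\<close> to \<open>Y\<close> and from
  \<open>V - y\<close> to \<open>W - Y\<close>, and gluing them gives a relabelling that carries the
  common block to \<open>Y\<close>. The same relabelling is used for all three designs, so their
  common blocks are carried along. It also changes the type of the points.\<close>

lemma S_2_4_designs_relocate:
  fixes V y :: "'b set" and W Y :: "'a set"
  assumes "S_2_4_design v V \<B>1" "S_2_4_design v V \<B>2" "S_2_4_design v V \<B>3"
    and "exactly_common_blocks \<B>1 \<B>2 \<B>3 b"
    and "y \<in> \<B>1" "y \<in> \<B>2" "y \<in> \<B>3"
    and "finite W" "card W = v" "Y \<subseteq> W" "card Y = 4"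
  shows "\<exists>\<D>1 \<D>2 \<D>3. S_2_4_design v W \<D>1 \<and> S_2_4_design v W \<D>2 \<and> S_2_4_design v W \<D>3 \<and>
     exactly_common_blocks \<D>1 \<D>2 \<D>3 b \<and> Y \<in> \<D>1 \<and> Y \<in> \<D>2 \<and> Y \<in> \<D>3"
proof -
  have V: "finite V" "card V = v" "y \<subseteq> V" "card y = 4"
    and sub: "\<B>1 \<subseteq> Pow V" "\<B>2 \<subseteq> Pow V" "\<B>3 \<subseteq> Pow V"
    using assms(1-3) S_2_4_designD[OF assms(1,5)] unfolding S_2_4_design_def by auto
  have fin: "finite y" "finite Y"
    using V assms(8,10) finite_subset by auto
  obtain p where p: "bij_betw p y Y"
    using finite_same_card_bij[OF fin] V(4) assms(11) by auto
  have "card (V - y) = card (W - Y)"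
    using V assms(8-11) fin by (simp add: card_Diff_subset)
  then obtain q where q: "bij_betw q (V - y) (W - Y)"
    using finite_same_card_bij[of "V - y" "W - Y"] V(1) assms(8) by auto
  \<comment> \<open>Only the values on \<open>V\<close> matter. The two pieces have disjoint images,
    so the glued map is a bijection onto \<open>W\<close>.\<close>
  define f where "f x = (if x \<in> y then p x else q x)" for x
  have fy: "bij_betw f y Y"
    using p by (rule bij_betw_cong[THEN iffD1, rotated]) (simp add: f_def)
  moreover have "bij_betw f (V - y) (W - Y)"
    using q by (rule bij_betw_cong[THEN iffD1, rotated]) (simp add: f_def)
  ultimately have "bij_betw f (y \<union> (V - y)) (Y \<union> (W - Y))"
    by (rule bij_betw_combine) auto
  then have f: "inj_on f V" "f ` V = W"
    using V(3) assms(10) by (auto simp: bij_betw_def Un_absorb1)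
  have "f ` y = Y"
    using fy by (simp add: bij_betw_def)
  then have "Y \<in> (`) f ` \<B>1" "Y \<in> (`) f ` \<B>2" "Y \<in> (`) f ` \<B>3"
    using assms(5-7) by auto
  then show ?thesis
    using S_2_4_design_image[OF assms(1) f(1)] S_2_4_design_image[OF assms(2) f(1)]
      S_2_4_design_image[OF assms(3) f(1)]
      exactly_common_blocks_image[OF assms(4) inj_on_image_Pow[OF f(1)] sub]
    unfolding f(2) by (intro exI conjI)
qed

section \<open>Filling the groups\<close>

text \<open>Inserting \<open>Y\<close> only matters for an empty \<open>\<G>\<close> (the case \<open>s = 0\<close>), where the result is the single block \<open>Y\<close>.\<close>

definition fill :: "'a set \<Rightarrow> 'a set set \<Rightarrow> 'a set set \<Rightarrow> ('a set \<Rightarrow> 'a set set) \<Rightarrow> 'a set set" where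
  "fill Y \<G> \<A> D = \<A> \<union> insert Y (\<Union>G\<in>\<G>. D G)"

text \<open>Two points of distinct groups are joined only by a block of the GDD, two points of some
  \<open>G \<union> Y\<close> that are not both in \<open>Y\<close> only by a block of
  \<open>D G\<close>, and two points of \<open>Y\<close> only by \<open>Y\<close> itself. These
  three kinds exhaust the pairs in \<open>X \<union> Y\<close>.\<close>

lemma S_2_4_design_fill:
  assumes gdd: "GDD_4 X \<G> \<A>" and "X \<inter> Y = {}" and Y4: "card Y = 4"
    and D: "\<And>G. G \<in> \<G> \<Longrightarrow> S_2_4_design (card G + 4) (G \<union> Y) (D G)"
    and YD: "\<And>G. G \<in> \<G> \<Longrightarrow> Y \<in> D G"
  shows "S_2_4_design (card X + 4) (X \<union> Y) (fill Y \<G> \<A> D)"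
proof -
  have X: "finite X" "partition_on X \<G>" "\<And>A. A \<in> \<A> \<Longrightarrow> A \<subseteq> X" "\<And>A. A \<in> \<A> \<Longrightarrow> card A = 4"
    "\<And>A G. A \<in> \<A> \<Longrightarrow> G \<in> \<G> \<Longrightarrow> card (A \<inter> G) \<le> 1"
    "\<And>G H x y. G \<in> \<G> \<Longrightarrow> H \<in> \<G> \<Longrightarrow> G \<noteq> H \<Longrightarrow> x \<in> G \<Longrightarrow> y \<in> H \<Longrightarrow> \<exists>!A. A \<in> \<A> \<and> x \<in> A \<and> y \<in> A"
    using gdd unfolding GDD_4_def by auto
  have finY: "finite Y"
    using Y4 by (metis card.infinite zero_neq_numeral)
  have DB: "\<And>G B. G \<in> \<G> \<Longrightarrow> B \<in> D G \<Longrightarrow> B \<subseteq> G \<union> Y"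
    "\<And>G B. G \<in> \<G> \<Longrightarrow> B \<in> D G \<Longrightarrow> card B = 4"
    "\<And>G x y. G \<in> \<G> \<Longrightarrow> x \<in> G \<union> Y \<Longrightarrow> y \<in> G \<union> Y \<Longrightarrow> x \<noteq> y \<Longrightarrow> \<exists>!B. B \<in> D G \<and> x \<in> B \<and> y \<in> B"
    using D unfolding S_2_4_design_pairs by auto
  have GX: "G \<subseteq> X" if "G \<in> \<G>" for G
    using X(2) that unfolding partition_on_def by blast
  have GH: "G = H" if "G \<in> \<G>" "H \<in> \<G>" "x \<in> G" "x \<in> H" for G H x
    using partition_on_Int_empty[OF X(2)] that by blast
  have inG: "\<exists>G\<in>\<G>. x \<in> G" if "x \<in> X" for x
    using X(2) that unfolding partition_on_def by blast
  have block: "x = y" if "A \<in> \<A>" "G \<in> \<G>" "x \<in> A" "y \<in> A" "x \<in> G" "y \<in> G" for A G x y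
  proof -
    have "finite (A \<inter> G)"
      using X(1,3) that finite_subset by blast
    then show ?thesis
      using X(5)[OF that(1,2)] card_le_Suc0_iff_eq[of "A \<inter> G"] that by auto
  qed
  have mixed: "\<exists>!B. B \<in> fill Y \<G> \<A> D \<and> x \<in> B \<and> y \<in> B"
    if G: "G \<in> \<G>" and x: "x \<in> G" and y: "y \<in> G \<union> Y" and ne: "x \<noteq> y" for G x y
  proof -
    \<comment> \<open>The point \<open>x\<close> lies in no other group and not in \<open>Y\<close>,
      so a filling block through it belongs to \<open>D G\<close>. A GDD block through
      \<open>x\<close> and \<open>y\<close> avoids \<open>Y\<close>, hence would meet
      \<open>G\<close> in two points.\<close>
    have "B \<in> fill Y \<G> \<A> D \<and> x \<in> B \<and> y \<in> B \<longleftrightarrow> B \<in> D G \<and> x \<in> B \<and> y \<in> B" for B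
    proof
      assume B: "B \<in> fill Y \<G> \<A> D \<and> x \<in> B \<and> y \<in> B"
      have xY: "x \<notin> Y" using x GX[OF G] assms(2) by blast
      have "B \<notin> \<A>"
      proof
        assume "B \<in> \<A>"
        then have "y \<in> G" using B y X(3) assms(2) by blast
        then show False using block[OF \<open>B \<in> \<A>\<close> G] B x ne by blast
      qed
      then obtain H where H: "H \<in> \<G>" "B \<in> D H"
        using B xY unfolding fill_def by blast
      then have "x \<in> H" using DB(1) B xY by blast
      then have "H = G" using GH G H x by blast
      then show "B \<in> D G \<and> x \<in> B \<and> y \<in> B" using H B by blast
    qed (use G in \<open>auto simp: fill_def\<close>)
    then show ?thesis
      using DB(3)[OF G, of x y] x y ne by simp
  qed
  have cross: "\<exists>!B. B \<in> fill Y \<G> \<A> D \<and> x \<in> B \<and> y \<in> B"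
    if "G \<in> \<G>" "H \<in> \<G>" "G \<noteq> H" "x \<in> G" "y \<in> H" for G H x y
  proof -
    have xy: "x \<notin> Y" "y \<notin> Y"
      using that GX assms(2) by blast+
    \<comment> \<open>A filling block for a group \<open>K\<close> lies in
      \<open>K \<union> Y\<close>, so it would put \<open>x\<close> and \<open>y\<close> into the
      same group.\<close>
    have "B \<in> \<A>" if B: "B \<in> fill Y \<G> \<A> D" "x \<in> B" "y \<in> B" for B
    proof (rule ccontr)
      assume "B \<notin> \<A>"
      then obtain K where "K \<in> \<G>" "B \<in> D K"
        using B xy unfolding fill_def by blast
      then have "K \<in> \<G>" "x \<in> K" "y \<in> K" using DB(1) B xy by blast+
      then show False using GH \<open>G \<in> \<G>\<close> \<open>H \<in> \<G>\<close> \<open>G \<noteq> H\<close> \<open>x \<in> G\<close> \<open>y \<in> H\<close> by blast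
    qed
    then have "B \<in> fill Y \<G> \<A> D \<and> x \<in> B \<and> y \<in> B \<longleftrightarrow> B \<in> \<A> \<and> x \<in> B \<and> y \<in> B" for B
      by (auto simp: fill_def)
    then show ?thesis
      using X(6)[OF that] by simp
  qed
  have "\<exists>!B. B \<in> fill Y \<G> \<A> D \<and> x \<in> B \<and> y \<in> B"
    if xy: "x \<in> X \<union> Y" "y \<in> X \<union> Y" "x \<noteq> y" for x y
  proof -
    consider "x \<in> X" "y \<in> X" | "x \<in> X" "y \<in> Y" | "x \<in> Y" "y \<in> X" | "x \<in> Y" "y \<in> Y"
      using xy by blast
    then show ?thesis
    proof cases
      case 1
      then obtain G H where "G \<in> \<G>" "H \<in> \<G>" "x \<in> G" "y \<in> H" using inG by blast
      then show ?thesis using mixed[of G x y] cross[of G H x y] xy(3) by blast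
    next
      case 2
      then obtain G where "G \<in> \<G>" "x \<in> G" using inG by blast
      then show ?thesis using mixed[of G x y] xy(3) 2 by blast
    next
      case 3
      then obtain G where "G \<in> \<G>" "y \<in> G" using inG by blast
      then have "\<exists>!B. B \<in> fill Y \<G> \<A> D \<and> y \<in> B \<and> x \<in> B"
        using mixed[of G y x] xy(3) 3 by blast
      then show ?thesis by (simp add: conj_commute)
    next
      case 4
      \<comment> \<open>GDD blocks miss \<open>Y\<close>. A block of \<open>D G\<close> through
        \<open>x\<close> and \<open>y\<close> equals \<open>Y\<close>, because \<open>Y\<close> is
        itself a block of \<open>D G\<close> through these two points.\<close>
      have "B = Y" if B: "B \<in> fill Y \<G> \<A> D" "x \<in> B" "y \<in> B" for B
      proof (rule ccontr)
        assume "B \<noteq> Y"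
        moreover have "B \<notin> \<A>" using X(3) B 4 assms(2) by blast
        ultimately obtain G where G: "G \<in> \<G>" "B \<in> D G"
          using B unfolding fill_def by blast
        then show False
          using DB(3)[OF G(1), of x y] YD[OF G(1)] B 4 xy(3) \<open>B \<noteq> Y\<close> by blast
      qed
      moreover have "Y \<in> fill Y \<G> \<A> D" by (simp add: fill_def)
      ultimately show ?thesis using 4 by blast
    qed
  qed
  moreover have "B \<subseteq> X \<union> Y \<and> card B = 4" if B: "B \<in> fill Y \<G> \<A> D" for B
  proof -
    consider "B \<in> \<A>" | "B = Y" | G where "G \<in> \<G>" "B \<in> D G"
      using B unfolding fill_def by blast
    then show ?thesis
      by cases (use X(3,4) Y4 DB(1,2) GX in blast)+
  qed
  moreover have "card (X \<union> Y) = card X + 4"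
    using X(1) finY Y4 assms(2) by (simp add: card_Un_disjoint)
  ultimately show ?thesis
    unfolding S_2_4_design_pairs using X(1) finY by simp
qed

section \<open>Common blocks of filled designs\<close>

text \<open>A GDD block avoids \<open>Y\<close>, so inside \<open>G \<union> Y\<close> all four of
  its points would be in \<open>G\<close>, which it meets at most once. This keeps GDD blocks apart
  from the blocks of every filling.\<close>

lemma GDD_4_block_not_in_group:
  assumes "GDD_4 X \<G> \<A>" "X \<inter> Y = {}" "A \<in> \<A>" "G \<in> \<G>"
  shows "\<not> A \<subseteq> G \<union> Y"
proof
  assume "A \<subseteq> G \<union> Y"
  have A: "A \<subseteq> X" "card A = 4" "card (A \<inter> G) \<le> 1"
    using GDD_4D[OF assms(1)] assms(3,4) by simp_all
  then have "A \<inter> G = A"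
    using \<open>A \<subseteq> G \<union> Y\<close> assms(2) by blast
  then show False
    using A by simp
qed

text \<open>No common block arises from parts of different kinds, except \<open>Y\<close>: a GDD
  block is never a filling block, and a block common to fillings of distinct groups lies in
  \<open>Y\<close> and has four points. The intersection thus has the form of a filling again and
  can be counted by the same formula.\<close>

lemma fill_Int:
  assumes gdd: "GDD_4 X \<G> \<A>" "GDD_4 X \<G> \<A>'" and "X \<inter> Y = {}" and Y4: "card Y = 4"
    and D: "\<And>G. G \<in> \<G> \<Longrightarrow> S_2_4_design (card G + 4) (G \<union> Y) (D G)"
    and D': "\<And>G. G \<in> \<G> \<Longrightarrow> S_2_4_design (card G + 4) (G \<union> Y) (D' G)"
  shows "fill Y \<G> \<A> D \<inter> fill Y \<G> \<A>' D' = fill Y \<G> (\<A> \<inter> \<A>') (\<lambda>G. D G \<inter> D' G)"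
proof -
  have sub: "B \<subseteq> G \<union> Y" "card B = 4" if "G \<in> \<G>" "B \<in> D G \<or> B \<in> D' G" for G B
    using S_2_4_designD[OF D] S_2_4_designD[OF D'] that by meson+
  have Y: "\<not> A \<subseteq> Y" if "A \<in> \<A> \<or> A \<in> \<A>'" for A
  proof
    assume "A \<subseteq> Y"
    moreover have "A \<subseteq> X" "card A = 4"
      using GDD_4D(3,4)[OF gdd(1)] GDD_4D(3,4)[OF gdd(2)] that by blast+
    ultimately have "A = {}" using assms(3) by blast
    then show False using \<open>card A = 4\<close> by simp
  qed
  have no: "A \<notin> D G \<and> A \<notin> D' G" if "A \<in> \<A> \<or> A \<in> \<A>'" "G \<in> \<G>" for A G
    using GDD_4_block_not_in_group[OF gdd(1) assms(3)] GDD_4_block_not_in_group[OF gdd(2) assms(3)]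
      that sub(1) by blast
  have GH: "B = Y" if "G \<in> \<G>" "H \<in> \<G>" "G \<noteq> H" "B \<in> D G" "B \<in> D' H" for G H B
  proof -
    have "G \<inter> H = {}"
      using partition_on_Int_empty GDD_4D(2)[OF gdd(1)] that by blast
    then have "B \<subseteq> Y" using sub(1)[of G B] sub(1)[of H B] that by blast
    moreover have "finite Y" using Y4 by (metis card.infinite zero_neq_numeral)
    ultimately show ?thesis
      using sub(2)[of G B] that Y4 by (metis card_subset_eq)
  qed
  show ?thesis
  proof (intro equalityI subsetI)
    fix B assume "B \<in> fill Y \<G> \<A> D \<inter> fill Y \<G> \<A>' D'"
    \<comment> \<open>The third and fourth cases are impossible by \<open>no\<close>; in the fifth,
      distinct groups force \<open>B = Y\<close> by \<open>GH\<close>.\<close>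
    then consider "B = Y" | "B \<in> \<A>" "B \<in> \<A>'" | G where "B \<in> \<A>" "G \<in> \<G>" "B \<in> D' G"
      | G where "B \<in> \<A>'" "G \<in> \<G>" "B \<in> D G"
      | G H where "G \<in> \<G>" "H \<in> \<G>" "B \<in> D G" "B \<in> D' H"
      unfolding fill_def by blast
    then show "B \<in> fill Y \<G> (\<A> \<inter> \<A>') (\<lambda>G. D G \<inter> D' G)"
    proof cases
      case (5 G H)
      then show ?thesis
        using GH[of G H B] by (cases "G = H") (auto simp: fill_def)
    qed (use no in \<open>auto simp: fill_def\<close>)
  qed (auto simp: fill_def)
qed

text \<open>With \<open>Y\<close> removed, the sets \<open>D G\<close> become pairwise disjoint and
  each loses one element; \<open>Y\<close> is then added back once. The count is over the integers,
  since for empty \<open>\<G>\<close> the correction is \<open>+1\<close>, accounting for the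
  inserted \<open>Y\<close>.\<close>

lemma card_fill:
  assumes "finite \<G>" "finite \<A>" "Y \<notin> \<A>"
    and "\<And>G. G \<in> \<G> \<Longrightarrow> finite (D G)" "\<And>G. G \<in> \<G> \<Longrightarrow> Y \<in> D G"
    and "\<And>G. G \<in> \<G> \<Longrightarrow> \<A> \<inter> D G = {}"
    and "\<And>G H. G \<in> \<G> \<Longrightarrow> H \<in> \<G> \<Longrightarrow> G \<noteq> H \<Longrightarrow> D G \<inter> D H \<subseteq> {Y}"
  shows "finite (fill Y \<G> \<A> D)"
    and "int (card (fill Y \<G> \<A> D)) = int (card \<A>) + (\<Sum>G\<in>\<G>. int (card (D G))) - (int (card \<G>) - 1)"
proof -
  let ?U = "\<Union>G\<in>\<G>. D G - {Y}"
  have eq: "fill Y \<G> \<A> D = \<A> \<union> insert Y ?U"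
    unfolding fill_def by blast
  have finU: "finite ?U"
    using assms(1,4) by blast
  then show "finite (fill Y \<G> \<A> D)"
    unfolding eq using assms(2) by simp
  have "\<A> \<inter> insert Y ?U = {}"
    using assms(3,6) by blast
  moreover have "Y \<notin> ?U"
    by blast
  ultimately have "card (fill Y \<G> \<A> D) = card \<A> + Suc (card ?U)"
    unfolding eq using card_Un_disjoint[OF assms(2), of "insert Y ?U"]
      card_insert_disjoint[OF finU, of Y] finU by simp
  moreover have "card ?U = (\<Sum>G\<in>\<G>. card (D G - {Y}))"
    using assms(1,4,7) by (intro card_UN_disjoint) auto
  \<comment> \<open>As \<open>Y \<in> D G\<close>, the cardinality is positive and the truncated
    subtraction on naturals agrees with the one on integers.\<close>
  moreover have "int (card (D G - {Y})) = int (card (D G)) - 1" if "G \<in> \<G>" for G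
  proof -
    have "card (D G) > 0"
      using assms(4,5)[OF that] card_gt_0_iff by blast
    then show ?thesis
      using assms(5)[OF that] by (simp add: card_Diff_singleton of_nat_diff)
  qed
  ultimately show "int (card (fill Y \<G> \<A> D)) =
      int (card \<A>) + (\<Sum>G\<in>\<G>. int (card (D G))) - (int (card \<G>) - 1)"
    by (simp add: sum_subtractf)
qed

text \<open>By \<open>fill_Int\<close> and the hypotheses on common blocks, all three pairwise
  intersections are the single set \<open>?F\<close>, to which \<open>card_fill\<close>
  applies.\<close>

lemma exactly_common_blocks_fill:
  assumes gdd: "GDD_4 X \<G> \<A>1" "GDD_4 X \<G> \<A>2" "GDD_4 X \<G> \<A>3"
    and common: "exactly_common_blocks \<A>1 \<A>2 \<A>3 b"
    and disj: "X \<inter> Y = {}" and Y4: "card Y = 4"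
    and D: "\<And>G. G \<in> \<G> \<Longrightarrow> S_2_4_design (card G + 4) (G \<union> Y) (D1 G)"
      "\<And>G. G \<in> \<G> \<Longrightarrow> S_2_4_design (card G + 4) (G \<union> Y) (D2 G)"
      "\<And>G. G \<in> \<G> \<Longrightarrow> S_2_4_design (card G + 4) (G \<union> Y) (D3 G)"
    and Dcommon: "\<And>G. G \<in> \<G> \<Longrightarrow> exactly_common_blocks (D1 G) (D2 G) (D3 G) (c G)"
    and YD: "\<And>G. G \<in> \<G> \<Longrightarrow> Y \<in> D1 G" "\<And>G. G \<in> \<G> \<Longrightarrow> Y \<in> D2 G"
  shows "\<exists>n. exactly_common_blocks (fill Y \<G> \<A>1 D1) (fill Y \<G> \<A>2 D2) (fill Y \<G> \<A>3 D3) n \<and>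
    int n = int b + (\<Sum>G\<in>\<G>. int (c G)) - (int (card \<G>) - 1)"
proof -
  let ?F = "fill Y \<G> (\<A>1 \<inter> \<A>2) (\<lambda>G. D1 G \<inter> D2 G)"
  have cA: "\<A>1 \<inter> \<A>3 = \<A>1 \<inter> \<A>2" "\<A>2 \<inter> \<A>3 = \<A>1 \<inter> \<A>2" "finite (\<A>1 \<inter> \<A>2)" "card (\<A>1 \<inter> \<A>2) = b"
    using common unfolding exactly_common_blocks_def by auto
  have cD: "D1 G \<inter> D3 G = D1 G \<inter> D2 G" "D2 G \<inter> D3 G = D1 G \<inter> D2 G"
      "finite (D1 G \<inter> D2 G)" "card (D1 G \<inter> D2 G) = c G" if "G \<in> \<G>" for G
    using Dcommon[OF that] unfolding exactly_common_blocks_def by auto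
  have fill_eq: "fill Y \<G> (\<A>1 \<inter> \<A>3) (\<lambda>G. D1 G \<inter> D3 G) = ?F"
    "fill Y \<G> (\<A>2 \<inter> \<A>3) (\<lambda>G. D2 G \<inter> D3 G) = ?F"
    unfolding fill_def using cA(1,2) cD(1,2) by auto
  have Int: "fill Y \<G> \<A>1 D1 \<inter> fill Y \<G> \<A>2 D2 = ?F" "fill Y \<G> \<A>1 D1 \<inter> fill Y \<G> \<A>3 D3 = ?F"
    "fill Y \<G> \<A>2 D2 \<inter> fill Y \<G> \<A>3 D3 = ?F"
    using fill_Int[OF gdd(1,2) disj Y4 D(1,2)] fill_Int[OF gdd(1,3) disj Y4 D(1,3)]
      fill_Int[OF gdd(2,3) disj Y4 D(2,3)] fill_eq by simp_all
  have X: "finite X" "partition_on X \<G>" "\<And>A. A \<in> \<A>1 \<Longrightarrow> A \<subseteq> X \<and> card A = 4"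
    using GDD_4D[OF gdd(1)] by auto
  have sub: "B \<subseteq> G \<union> Y" "card B = 4" if "G \<in> \<G>" "B \<in> D1 G" for G B
    using S_2_4_designD[OF D(1)] that by meson+
  have "finite \<G>"
    using X(1,2) by (rule finite_elements)
  moreover have "Y \<notin> \<A>1 \<inter> \<A>2"
  proof
    assume "Y \<in> \<A>1 \<inter> \<A>2"
    then have "Y = {}" using X(3) disj by blast
    then show False using Y4 by simp
  qed
  moreover have "(\<A>1 \<inter> \<A>2) \<inter> (D1 G \<inter> D2 G) = {}" if "G \<in> \<G>" for G
    using GDD_4_block_not_in_group[OF gdd(1) disj] sub(1) that by blast
  moreover have "(D1 G \<inter> D2 G) \<inter> (D1 H \<inter> D2 H) \<subseteq> {Y}" if GH: "G \<in> \<G>" "H \<in> \<G>" "G \<noteq> H" for G H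
  proof
    fix B assume B: "B \<in> (D1 G \<inter> D2 G) \<inter> (D1 H \<inter> D2 H)"
    have "G \<inter> H = {}"
      using partition_on_Int_empty X(2) GH by blast
    then have "B \<subseteq> Y" using sub(1)[of G B] sub(1)[of H B] GH B by blast
    moreover have "finite Y" using Y4 by (metis card.infinite zero_neq_numeral)
    ultimately have "B = Y"
      using sub(2)[of G B] GH B Y4 by (metis IntD1 card_subset_eq)
    then show "B \<in> {Y}" by simp
  qed
  ultimately have "finite ?F" and "int (card ?F) =
      int (card (\<A>1 \<inter> \<A>2)) + (\<Sum>G\<in>\<G>. int (card (D1 G \<inter> D2 G))) - (int (card \<G>) - 1)"
    using card_fill[of \<G> "\<A>1 \<inter> \<A>2" Y "\<lambda>G. D1 G \<inter> D2 G"] cA(3) cD(3) YD by auto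
  then show ?thesis
    unfolding exactly_common_blocks_def using Int cA(4) cD(4) by auto
qed

section \<open>Assembling the three designs\<close>

theorem theorem3p3:
  fixes s b :: nat and g bs :: "nat \<Rightarrow> nat"
  assumes "\<exists>(X :: 'a set) \<G> \<A>1 \<A>2 \<A>3.
      has_group_type \<G> s g \<and>
      GDD_4 X \<G> \<A>1 \<and> GDD_4 X \<G> \<A>2 \<and> GDD_4 X \<G> \<A>3 \<and>
      exactly_common_blocks \<A>1 \<A>2 \<A>3 b"
    and "\<forall>i\<in>{1..s}. \<exists>(V :: 'b set) \<B>1 \<B>2 \<B>3 y.
      S_2_4_design (g i + 4) V \<B>1 \<and> S_2_4_design (g i + 4) V \<B>2 \<and> S_2_4_design (g i + 4) V \<B>3 \<and>
      exactly_common_blocks \<B>1 \<B>2 \<B>3 (bs i) \<and>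
      y \<in> \<B>1 \<and> y \<in> \<B>2 \<and> y \<in> \<B>3"
  shows "\<exists>(V :: nat set) \<B>1 \<B>2 \<B>3 c.
      S_2_4_design ((\<Sum>i=1..s. g i) + 4) V \<B>1 \<and>
      S_2_4_design ((\<Sum>i=1..s. g i) + 4) V \<B>2 \<and>
      S_2_4_design ((\<Sum>i=1..s. g i) + 4) V \<B>3 \<and>
      exactly_common_blocks \<B>1 \<B>2 \<B>3 c \<and>
      int c = int b + (\<Sum>i=1..s. int (bs i)) - (int s - 1)"
proof -
  obtain X :: "'a set" and \<G> \<A>1 \<A>2 \<A>3 where type: "has_group_type \<G> s g"
    and gdd: "GDD_4 X \<G> \<A>1" "GDD_4 X \<G> \<A>2" "GDD_4 X \<G> \<A>3"
    and common: "exactly_common_blocks \<A>1 \<A>2 \<A>3 b"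
    using assms(1) by blast
  have X: "finite X" "partition_on X \<G>"
    using GDD_4D[OF gdd(1)] by simp_all
  \<comment> \<open>The type of \<open>X\<close> may have no four further points, so the GDDs are
    moved to the naturals. The shift by 4 reserves 0, 1, 2, 3 for \<open>Y\<close>.\<close>
  define f where "f x = to_nat_on X x + 4" for x
  have f: "inj_on f X"
    using inj_on_to_nat_on[OF countable_finite[OF X(1)]] unfolding f_def inj_on_def by simp
  define Y :: "nat set" where "Y = {..<4}"
  have Y4: "card Y = 4" and disj: "f ` X \<inter> Y = {}"
    by (auto simp: Y_def f_def)
  let ?G = "(`) f ` \<G>"
  note gdd' = gdd[THEN GDD_4_image, OF f]
  have sub: "\<A>1 \<subseteq> Pow X" "\<A>2 \<subseteq> Pow X" "\<A>3 \<subseteq> Pow X"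
    using gdd[THEN GDD_4D(3)] by auto
  note common' = exactly_common_blocks_image[OF common inj_on_image_Pow[OF f] sub]
  obtain G where G: "bij_betw G {1..s} \<G>" "\<And>i. i \<in> {1..s} \<Longrightarrow> card (G i) = g i"
    using type unfolding has_group_type_def by blast
  have GX: "H \<subseteq> X" if "H \<in> \<G>" for H
    using X(2) that unfolding partition_on_def by blast
  have "bij_betw ((`) f) \<G> ?G"
    using GX by (intro inj_on_imp_bij_betw inj_on_subset[OF inj_on_image_Pow[OF f]]) auto
  then have "bij_betw ((`) f \<circ> G) {1..s} ?G"
    using G(1) bij_betw_trans by blast
  moreover define K where "K = (`) f \<circ> G"
  ultimately have K: "bij_betw K {1..s} ?G"
    by simp
  have cardK: "card (K i) = g i" if "i \<in> {1..s}" for i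
  proof -
    have "G i \<subseteq> X"
      using GX bij_betwE[OF G(1)] that by blast
    then show ?thesis
      using G(2)[OF that] card_image[OF inj_on_subset[OF f]] by (simp add: K_def)
  qed
  \<comment> \<open>The numbers \<open>bs\<close> are indexed by positions and the fillings by
    groups. Recovering the position from the group itself matters, as groups of equal size may have
    different values of \<open>bs\<close>.\<close>
  define idx where "idx = the_inv_into {1..s} K"
  have idx: "idx (K i) = i" if "i \<in> {1..s}" for i
    using that K unfolding idx_def by (simp add: bij_betw_def the_inv_into_f_f)
  have part': "partition_on (f ` X) ?G" and finX: "finite (f ` X)"
    using GDD_4D[OF gdd'(1)] by simp_all
  \<comment> \<open>Bundling the conditions on a triple into one predicate lets a single use of
    choice produce \<open>D1\<close>, \<open>D2\<close> and \<open>D3\<close> together.\<close>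
  define fills where "fills H \<D>1 \<D>2 \<D>3 \<longleftrightarrow> S_2_4_design (card H + 4) (H \<union> Y) \<D>1 \<and>
      S_2_4_design (card H + 4) (H \<union> Y) \<D>2 \<and> S_2_4_design (card H + 4) (H \<union> Y) \<D>3 \<and>
      exactly_common_blocks \<D>1 \<D>2 \<D>3 (bs (idx H)) \<and> Y \<in> \<D>1 \<and> Y \<in> \<D>2 \<and> Y \<in> \<D>3" for H \<D>1 \<D>2 \<D>3
  have "\<exists>\<D>1 \<D>2 \<D>3. fills H \<D>1 \<D>2 \<D>3" if H: "H \<in> ?G" for H
  proof -
    obtain i where i: "i \<in> {1..s}" "H = K i"
      using H bij_betw_imp_surj_on[OF K] by (metis imageE)
    have g: "g i = card H" and bi: "idx H = i"
      using cardK idx i by simp_all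
    have HX: "H \<subseteq> f ` X"
      using H GX by auto
    then have finH: "finite H"
      using finX finite_subset by blast
    then have cardHY: "card (H \<union> Y) = card H + 4" and finHY: "finite (H \<union> Y)"
      using HX disj Y4 by (auto simp: Y_def intro!: card_Un_disjoint[THEN trans])
    obtain V :: "'b set" and \<B>1 \<B>2 \<B>3 y where V: "S_2_4_design (card H + 4) V \<B>1"
      "S_2_4_design (card H + 4) V \<B>2" "S_2_4_design (card H + 4) V \<B>3"
      "exactly_common_blocks \<B>1 \<B>2 \<B>3 (bs (idx H))" "y \<in> \<B>1" "y \<in> \<B>2" "y \<in> \<B>3"
      using assms(2) i(1) unfolding bi g[symmetric] by meson
    show ?thesis
      unfolding fills_def by (rule S_2_4_designs_relocate[OF V finHY cardHY Un_upper2 Y4])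
  qed
  then obtain D1 D2 D3 where "\<And>H. H \<in> ?G \<Longrightarrow> fills H (D1 H) (D2 H) (D3 H)"
    by metis
  then have D:
    "\<And>H. H \<in> ?G \<Longrightarrow> S_2_4_design (card H + 4) (H \<union> Y) (D1 H)"
    "\<And>H. H \<in> ?G \<Longrightarrow> S_2_4_design (card H + 4) (H \<union> Y) (D2 H)"
    "\<And>H. H \<in> ?G \<Longrightarrow> S_2_4_design (card H + 4) (H \<union> Y) (D3 H)"
    "\<And>H. H \<in> ?G \<Longrightarrow> exactly_common_blocks (D1 H) (D2 H) (D3 H) (bs (idx H))"
    "\<And>H. H \<in> ?G \<Longrightarrow> Y \<in> D1 H" "\<And>H. H \<in> ?G \<Longrightarrow> Y \<in> D2 H" "\<And>H. H \<in> ?G \<Longrightarrow> Y \<in> D3 H"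
    unfolding fills_def by simp_all
  have "card (f ` X) = (\<Sum>H\<in>?G. card H)"
    using part'
  proof (rule product_partition)
    show "finite H" if "H \<in> ?G" for H
      using that finite_subset[OF GX X(1)] by auto
  qed
  \<comment> \<open>Summing over groups equals summing over positions because \<open>K\<close> is a
    bijection; groups of equal size are counted separately.\<close>
  also have "\<dots> = (\<Sum>i=1..s. g i)"
    using sum.reindex_bij_betw[OF K, of card] cardK by simp
  finally have cardX: "card (f ` X) = (\<Sum>i=1..s. g i)" .
  have cardG: "card ?G = s"
    using bij_betw_same_card[OF K] by simp
  have bsum: "(\<Sum>H\<in>?G. int (bs (idx H))) = (\<Sum>i=1..s. int (bs i))"
    using sum.reindex_bij_betw[OF K, of "\<lambda>H. int (bs (idx H))"] idx by simp
  obtain n where n: "exactly_common_blocks (fill Y ?G ((`) f ` \<A>1) D1) (fill Y ?G ((`) f ` \<A>2) D2)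
      (fill Y ?G ((`) f ` \<A>3) D3) n"
    "int n = int b + (\<Sum>i=1..s. int (bs i)) - (int s - 1)"
    using exactly_common_blocks_fill[OF gdd' common' disj Y4 D(1-6)] unfolding cardG bsum by blast
  show ?thesis
    using S_2_4_design_fill[OF gdd'(1) disj Y4 D(1) D(5)] S_2_4_design_fill[OF gdd'(2) disj Y4 D(2) D(6)]
      S_2_4_design_fill[OF gdd'(3) disj Y4 D(3) D(7)] n
    unfolding cardX by (intro exI conjI)
qed

end
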